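(* Let $\mathcal P_o=(P,R,g)$ be a normalised OPS instance. For all $x>2$, the maximum heat achieved by any edge in the schedule produced by Reduce-Fastest$(x)$ is at most $$\max\left\{x+\frac{x^2}{4(x-2)},\; x+\frac12+\frac{x^2}{4(x-1)}\right\}.$$
   Context: An OPS instance $(P,R,g)$ consists of a finite simple undirected graph $(P,R)$ with growth rates $g:R\to\mathbb R_{>0}$. For $v\in P$ let $G_v=\sum_{e\ni v} g(e)$ and $G^*=\max_v G_v$; normalised means $G^*=1$. Reduce-Fastest$(x)$: sort edges by non-increasing growth rate (ties broken by an arbitrary fixed ordering). Each edge has a current heat, initially $0$, increasing by $g(e)$ at the start of each day. Each day a matching $M$ is built greedily: in sorted order, $e=\{u,v\}$ is added to $M$ iff its current heat is at least $xG^*$ and no edge incident to $u$ or $v$ is already in $M$; edges in $M$ are scheduled that day and their current heat reset to $0$. *)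

theory Defs
  imports Complex_Main
begin

locale ops_instance =
  fixes P :: "'a set" and R :: "'a set set" and g :: "'a set \<Rightarrow> real"
  assumes finite_P: "finite P"
    and simple_edges: "e \<in> R \<Longrightarrow> e \<subseteq> P \<and> card e = 2"
    and growth_pos: "e \<in> R \<Longrightarrow> 0 < g e"

definition vertex_growth :: "'a set set \<Rightarrow> ('a set \<Rightarrow> real) \<Rightarrow> 'a \<Rightarrow> real" where
  "vertex_growth R g v = (\<Sum>e | e \<in> R \<and> v \<in> e. g e)"

definition max_growth :: "'a set \<Rightarrow> 'a set set \<Rightarrow> ('a set \<Rightarrow> real) \<Rightarrow> real" where
  "max_growth P R g = Max (vertex_growth R g ` P)"

definition normalised :: "'a set \<Rightarrow> 'a set set \<Rightarrow> ('a set \<Rightarrow> real) \<Rightarrow> bool" where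
  "normalised P R g \<longleftrightarrow> P \<noteq> {} \<and> max_growth P R g = 1"

text \<open>
  An enumeration of the edges by non-increasing growth rate. The relative order of edges of
  equal growth rate is unconstrained, so each admissible list is one choice of tie-breaking.
\<close>

definition fastest_first :: "'a set set \<Rightarrow> ('a set \<Rightarrow> real) \<Rightarrow> 'a set list \<Rightarrow> bool" where
  "fastest_first R g es \<longleftrightarrow>
     distinct es \<and> set es = R \<and> sorted_wrt (\<lambda>e f. g e \<ge> g f) es"

definition greedy_matching :: "real \<Rightarrow> ('a set \<Rightarrow> real) \<Rightarrow> 'a set list \<Rightarrow> 'a set set" where
  "greedy_matching \<theta> h es =
     fold (\<lambda>e M. if \<theta> \<le> h e \<and> (\<forall>f\<in>M. e \<inter> f = {}) then insert e M else M) es {}"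

text \<open>
  \<open>rf_start_heat P R g es x d e\<close> is the heat of \<open>e\<close> on day \<open>d = 0, 1, \<dots>\<close> before that day's
  growth, and \<open>rf_heat\<close> is the heat after it; the latter is what the algorithm inspects and
  what the heat of the schedule is measured by.
\<close>

primrec rf_start_heat ::
  "'a set \<Rightarrow> 'a set set \<Rightarrow> ('a set \<Rightarrow> real) \<Rightarrow> 'a set list \<Rightarrow> real \<Rightarrow> nat \<Rightarrow> 'a set \<Rightarrow> real" where
  "rf_start_heat P R g es x 0 = (\<lambda>e. 0)"
| "rf_start_heat P R g es x (Suc d) =
     (let h = (\<lambda>e. rf_start_heat P R g es x d e + g e);
          M = greedy_matching (x * max_growth P R g) h es
      in (\<lambda>e. if e \<in> M then 0 else h e))"

definition rf_heat ::
  "'a set \<Rightarrow> 'a set set \<Rightarrow> ('a set \<Rightarrow> real) \<Rightarrow> 'a set list \<Rightarrow> real \<Rightarrow> nat \<Rightarrow> 'a set \<Rightarrow> real" where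
  "rf_heat P R g es x d e = rf_start_heat P R g es x d e + g e"

end

theory Submission
  imports Defs
begin

text \<open>
  Let \<open>e\<close> be an edge of growth \<open>\<gamma>\<close> that has been hot (heat at least \<open>x\<close>) but unscheduled for the
  last \<open>D\<close> days, so that its heat is at most \<open>x + (D + 1) * \<gamma>\<close>. On each of these days choose one
  scheduled edge, adjacent to \<open>e\<close> and of growth at least \<open>\<gamma>\<close>, that blocks \<open>e\<close>. A blocker \<open>f\<close> chosen
  \<open>n\<close> times satisfies \<open>(n - 1) * x \<le> g f * (last f - first f)\<close>, since it has to regain heat
  \<open>x\<close> between two days on which it is scheduled. Only one blocker is chosen per day, so the first
  days of the \<open>k\<close> blockers are distinct, and so are their last days. Summing over the blockers, whose
  total growth is at most \<open>2 * (1 - \<gamma>)\<close>, gives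
  \<open>(D - k) * x \<le> 2 * (1 - \<gamma>) * (D - 1) - \<gamma> * k * (k - 1)\<close>. In the limit of small \<open>\<gamma>\<close>, with
  \<open>\<kappa> = k * \<gamma>\<close> and \<open>y = D * \<gamma>\<close>, this reads \<open>y * (x - 2) \<le> \<kappa> * (x - \<kappa>) \<le> x\<^sup>2 / 4\<close>. The exact
  inequality yields the same bound on \<open>(D + 1) * \<gamma>\<close>, so the first term of the maximum suffices.
\<close>

section \<open>Sums of distinct days and counts of blocked days\<close>

lemma card_mult_pred_le_double_sum:
  fixes A :: "nat set"
  assumes "finite A"
  shows "real (card A) * (real (card A) - 1) \<le> 2 * real (\<Sum>A)"
  using assms
proof (induction A rule: finite_linorder_max_induct)
  case empty
  then show ?case by simp
next
  case (insert b A)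
  \<comment> \<open>The new maximum \<open>b\<close> lies above \<open>card A\<close> distinct
    naturals, so it adds at least \<open>card A\<close> to the sum.\<close>
  have "A \<subseteq> {..<b}" using insert.hyps by auto
  then have "card A \<le> b" using card_mono[of "{..<b}" A] by simp
  moreover have "b \<notin> A" using insert.hyps by auto
  ultimately show ?case using insert by (simp add: algebra_simps)
qed

lemma card_mult_pred_le_double_sum_inj:
  fixes p :: "'b \<Rightarrow> nat"
  assumes "finite F" "inj_on p F"
  shows "real (card F) * (real (card F) - 1) \<le> 2 * (\<Sum>f\<in>F. real (p f))"
  using card_mult_pred_le_double_sum[of "p ` F"] assms
  by (simp add: card_image sum.reindex)

text \<open>Each of the \<open>card S - 1\<close> gaps between consecutive elements costs at least
  \<open>c\<close>, and the gaps telescope.\<close>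

lemma separated_card_bound:
  fixes S :: "nat set" and c \<gamma> :: real
  assumes "finite S" "S \<noteq> {}"
    and "\<And>s t. s \<in> S \<Longrightarrow> t \<in> S \<Longrightarrow> s < t \<Longrightarrow> c \<le> (real t - real s) * \<gamma>"
  shows "(real (card S) - 1) * c \<le> (real (Max S) - real (Min S)) * \<gamma>"
  using assms
proof (induction S rule: finite_linorder_max_induct)
  case empty
  then show ?case by simp
next
  case (insert b A)
  show ?case
  proof (cases "A = {}")
    case True
    then show ?thesis by simp
  next
    case False
    have IH: "(real (card A) - 1) * c \<le> (real (Max A) - real (Min A)) * \<gamma>"
      using insert.IH False insert.prems by blast
    have mem: "Max A \<in> A" "Min A \<in> A" using insert.hyps False by auto
    have "c \<le> (real b - real (Max A)) * \<gamma>"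
      using insert.prems(2)[of "Max A" b] insert.hyps mem by auto
    moreover have "Max (insert b A) = b" "Min (insert b A) = Min A"
      using insert.hyps(1) insert.hyps(2)[rule_format, OF mem(1)]
        insert.hyps(2)[rule_format, OF mem(2)] False
      by (simp_all add: max_absorb1 min_absorb2 less_imp_le del: Min_le_iff Max_ge_iff)
    moreover have "b \<notin> A" using insert.hyps by auto
    ultimately show ?thesis using IH insert.hyps by (simp add: algebra_simps)
  qed
qed

lemma blocked_days_bound:
  fixes b :: "nat \<Rightarrow> 'b" and g :: "'b \<Rightarrow> real" and c \<gamma> G :: real
  assumes D: "0 < D"
    and gap: "\<And>s t. s < t \<Longrightarrow> t < D \<Longrightarrow> b s = b t \<Longrightarrow> c \<le> (real t - real s) * g (b t)"
    and \<gamma>: "0 \<le> \<gamma>" "\<And>t. t < D \<Longrightarrow> \<gamma> \<le> g (b t)"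
    and G: "sum g (b ` {..<D}) \<le> G"
  defines "k \<equiv> real (card (b ` {..<D}))"
  shows "(real D - k) * c \<le> G * (real D - 1) - \<gamma> * k * (k - 1)"
proof -
  define F where "F = b ` {..<D}"
  define S where "S f = {t. t < D \<and> b t = f}" for f
  have fin: "finite F" "finite (S f)" for f by (auto simp: F_def S_def)
  have mem: "Max (S f) \<in> S f" "Min (S f) \<in> S f" if "f \<in> F" for f
  proof -
    have "S f \<noteq> {}" using that by (auto simp: F_def S_def)
    then show "Max (S f) \<in> S f" "Min (S f) \<in> S f" using fin(2)[of f] by auto
  qed
  define p where "p f = Min (S f)" for f
  \<comment> \<open>Counting last days backwards from day \<open>D - 1\<close> makes them distinct
    naturals too, so they obey the same lower bound as the first days \<open>p f\<close>.\<close>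
  define q where "q f = D - 1 - Max (S f)" for f
  have maxD: "Max (S f) < D" "b (Max (S f)) = f" "b (Min (S f)) = f" if "f \<in> F" for f
    using mem[OF that] by (auto simp: S_def)
  have q: "real (q f) = real D - 1 - real (Max (S f))" if "f \<in> F" for f
    using maxD(1)[OF that] by (auto simp: q_def)
  have "inj_on p F"
    by (rule inj_onI) (metis maxD(3) p_def)
  then have p_sum: "k * (k - 1) \<le> 2 * (\<Sum>f\<in>F. real (p f))"
    using card_mult_pred_le_double_sum_inj[OF fin(1)] by (simp add: k_def F_def)
  have "inj_on q F"
  proof (rule inj_onI)
    fix f f' assume "f \<in> F" "f' \<in> F" "q f = q f'"
    then have "Max (S f) = Max (S f')" using q by (smt (verit) of_nat_eq_iff)
    then show "f = f'" using maxD(2) \<open>f \<in> F\<close> \<open>f' \<in> F\<close> by metis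
  qed
  then have q_sum: "k * (k - 1) \<le> 2 * (\<Sum>f\<in>F. real (q f))"
    using card_mult_pred_le_double_sum_inj[OF fin(1)] by (simp add: k_def F_def)
  have "(\<Union>f\<in>F. S f) = {..<D}" by (auto simp: F_def S_def)
  moreover have "card (\<Union>f\<in>F. S f) = (\<Sum>f\<in>F. card (S f))"
    by (rule card_UN_disjoint) (use fin in \<open>auto simp: S_def\<close>)
  ultimately have "real D = (\<Sum>f\<in>F. real (card (S f)))"
    by (metis card_lessThan of_nat_sum)
  then have "(real D - k) * c = (\<Sum>f\<in>F. (real (card (S f)) - 1) * c)"
    by (simp add: sum_subtractf k_def F_def flip: sum_distrib_right)
  also have "\<dots> \<le> (\<Sum>f\<in>F. g f * (real D - 1) - \<gamma> * (real (p f) + real (q f)))"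
  proof (rule sum_mono)
    fix f assume f: "f \<in> F"
    have "(real (card (S f)) - 1) * c \<le> (real (Max (S f)) - real (Min (S f))) * g f"
    proof (rule separated_card_bound)
      show "finite (S f)" "S f \<noteq> {}" using fin mem[OF f] by auto
      show "c \<le> (real t - real s) * g f" if "s \<in> S f" "t \<in> S f" "s < t" for s t
        using gap[of s t] that by (auto simp: S_def)
    qed
    also have "\<dots> = g f * (real D - 1) - g f * (real (p f) + real (q f))"
      by (simp add: q[OF f] p_def algebra_simps)
    \<comment> \<open>A common factor \<open>\<gamma>\<close> on the lost days is needed before
      their distinctness can be used.\<close>
    also have "\<dots> \<le> g f * (real D - 1) - \<gamma> * (real (p f) + real (q f))"
    proof -
      have "\<gamma> \<le> g f" using f \<gamma>(2) by (auto simp: F_def)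
      then show ?thesis by (simp add: mult_right_mono)
    qed
    finally show "(real (card (S f)) - 1) * c \<le> \<dots>" .
  qed
  also have "\<dots> = sum g F * (real D - 1)
      - \<gamma> * ((\<Sum>f\<in>F. real (p f)) + (\<Sum>f\<in>F. real (q f)))"
    by (simp add: sum_subtractf sum.distrib flip: sum_distrib_left sum_distrib_right)
  also have "\<dots> \<le> G * (real D - 1) - \<gamma> * (k * (k - 1))"
  proof -
    have "sum g F * (real D - 1) \<le> G * (real D - 1)"
      using D G by (intro mult_right_mono) (auto simp: F_def)
    moreover have "\<gamma> * (k * (k - 1)) \<le> \<gamma> * ((\<Sum>f\<in>F. real (p f)) + (\<Sum>f\<in>F. real (q f)))"
      using p_sum q_sum \<gamma>(1) by (intro mult_left_mono) auto
    ultimately show ?thesis by linarith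
  qed
  finally show ?thesis by (simp add: mult.assoc)
qed

section \<open>Optimising over the number of blockers\<close>

lemma two_le_excess_bound:
  fixes x :: real
  assumes "x > 2"
  shows "2 \<le> x\<^sup>2 / (4 * (x - 2))"
  using assms zero_le_power2[of "x - 4"] by (simp add: field_simps power2_eq_square)

text \<open>The parabola \<open>\<kappa> * (x - \<kappa>)\<close> peaks at \<open>x / 2\<close>. For
  \<open>x \<le> 4\<close> its peak value suffices; for larger \<open>x\<close> the peak lies beyond
  the range allowed by \<open>k\<close>, and the right end of that range is decisive.\<close>

lemma overheating_bound:
  fixes x \<gamma> k D :: real
  assumes x: "x > 2" and \<gamma>: "0 < \<gamma>" "\<gamma> \<le> 1" and k: "k * \<gamma> \<le> 2 * (1 - \<gamma>)"
    and days: "(D - k) * x \<le> 2 * (1 - \<gamma>) * (D - 1) - \<gamma> * k * (k - 1)"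
  shows "(D + 1) * \<gamma> \<le> x\<^sup>2 / (4 * (x - 2))"
proof -
  define Y where "Y = (D + 1) * \<gamma>"
  define \<kappa> where "\<kappa> = k * \<gamma>"
  have \<kappa>: "\<kappa> \<le> 2 - 2 * \<gamma>" using k by (simp add: \<kappa>_def)
  have "\<gamma> * ((D - k) * x) \<le> \<gamma> * (2 * (1 - \<gamma>) * (D - 1) - \<gamma> * k * (k - 1))"
    using days \<gamma> by (intro mult_left_mono) auto
  then have main: "Y * (x - 2) \<le> \<kappa> * (x - \<kappa>) + \<gamma> * (\<kappa> + x - 4 + 4 * \<gamma> - 2 * Y)"
    by (simp add: Y_def \<kappa>_def algebra_simps power2_eq_square)
  note two = two_le_excess_bound[OF x]
  have "\<gamma> * \<kappa> \<le> \<gamma> * (2 - 2 * \<gamma>)" using \<kappa> \<gamma> by (intro mult_left_mono) auto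
  then have main': "Y * (x - 2) \<le> \<kappa> * (x - \<kappa>) + \<gamma> * (x - 2 + 2 * \<gamma> - 2 * Y)"
    using main by (simp add: algebra_simps)
  show ?thesis
  proof (cases "x \<le> 4")
    case True
    have "Y \<le> x\<^sup>2 / (4 * (x - 2))"
    proof (rule ccontr)
      assume neg: "\<not> Y \<le> x\<^sup>2 / (4 * (x - 2))"
      then have "\<gamma> * (x - 2 + 2 * \<gamma> - 2 * Y) \<le> 0"
        using two True \<gamma> by (intro mult_nonneg_nonpos) auto
      moreover have "\<kappa> * (x - \<kappa>) \<le> x\<^sup>2 / 4"
        using zero_le_power2[of "x - 2 * \<kappa>"] by (simp add: power2_eq_square algebra_simps)
      ultimately have "Y * (x - 2) \<le> x\<^sup>2 / 4" using main' by linarith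
      then show False using neg x by (simp add: field_simps)
    qed
    then show ?thesis by (simp add: Y_def)
  next
    case False
    \<comment> \<open>The product is the parabola at \<open>2 - 2 * \<gamma>\<close> minus its value
      at \<open>\<kappa>\<close>.\<close>
    have "0 \<le> (2 - 2 * \<gamma> - \<kappa>) * (x - \<kappa> - (2 - 2 * \<gamma>))"
      using \<kappa> \<gamma> False by (intro mult_nonneg_nonneg) auto
    then have "Y * (x - 2 + 2 * \<gamma>) \<le> (2 - \<gamma>) * (x - 2 + 2 * \<gamma>)"
      using main' by (simp add: algebra_simps)
    then have "Y \<le> 2 - \<gamma>" using x \<gamma> by (simp add: mult_le_cancel_right)
    then show ?thesis using two \<gamma> by (simp add: Y_def)
  qed
qed

section \<open>Greedy matchings\<close>

lemma greedy_matching_append: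
  "greedy_matching \<theta> h (es @ [e]) =
    (let M = greedy_matching \<theta> h es
     in if \<theta> \<le> h e \<and> (\<forall>f\<in>M. e \<inter> f = {}) then insert e M else M)"
  by (simp add: greedy_matching_def Let_def)

lemma greedy_matching_hot:
  "f \<in> greedy_matching \<theta> h es \<Longrightarrow> f \<in> set es \<and> \<theta> \<le> h f"
  by (induction es rule: rev_induct)
    (auto simp: greedy_matching_append Let_def greedy_matching_def split: if_splits)

text \<open>A hot edge is rejected only because of an edge accepted earlier, and the order makes
  earlier edges at least as fast.\<close>

lemma greedy_matching_blocker:
  assumes "sorted_wrt (\<lambda>e f. g e \<ge> g f) es" "e \<in> set es" "\<theta> \<le> h e"
    "e \<notin> greedy_matching \<theta> h es"
  shows "\<exists>f \<in> greedy_matching \<theta> h es. e \<inter> f \<noteq> {} \<and> g e \<le> (g f :: real)"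
  using assms
proof (induction es rule: rev_induct)
  case Nil
  then show ?case by simp
next
  case (snoc a es)
  show ?case
  proof (cases "e \<in> set es")
    case True
    then show ?thesis using snoc by (auto simp: greedy_matching_append Let_def sorted_wrt_append split: if_splits)
  next
    case False
    then have "a = e" using snoc.prems by auto
    then obtain f where "f \<in> greedy_matching \<theta> h es" "e \<inter> f \<noteq> {}"
      using snoc.prems by (auto simp: greedy_matching_append Let_def split: if_splits)
    moreover from this have "g e \<le> g f"
      using greedy_matching_hot[of f] snoc.prems(1) \<open>a = e\<close> by (auto simp: sorted_wrt_append)
    ultimately show ?thesis by (auto simp: greedy_matching_append Let_def)
  qed
qed

section \<open>Heat along the schedule\<close>

context
  fixes P :: "'a set" and R :: "'a set set" and g :: "'a set \<Rightarrow> real"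
    and es :: "'a set list" and x :: real
begin

definition rf_matching :: "nat \<Rightarrow> 'a set set" where
  "rf_matching d = greedy_matching (x * max_growth P R g) (rf_heat P R g es x d) es"

lemma rf_heat_0: "rf_heat P R g es x 0 e = g e"
  by (simp add: rf_heat_def)

lemma rf_heat_Suc:
  "rf_heat P R g es x (Suc d) e =
    (if e \<in> rf_matching d then 0 else rf_heat P R g es x d e) + g e"
  by (simp add: rf_heat_def[abs_def] rf_matching_def Let_def)

declare rf_heat_0 [simp] rf_heat_Suc [simp]

text \<open>Heat is read after the day's growth, hence \<open>Suc j\<close> increments; further
  resets in between only lower it.\<close>

lemma rf_heat_after_scheduled:
  assumes "f \<in> rf_matching s" "0 \<le> g f"
  shows "rf_heat P R g es x (Suc (s + j)) f \<le> real (Suc j) * g f"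
proof (induction j)
  case 0
  then show ?case using assms by simp
next
  case (Suc j)
  have "0 \<le> real (Suc j) * g f" using assms by simp
  then show ?case using Suc assms(2) rf_heat_Suc[of "Suc (s + j)" f]
    by (simp add: algebra_simps del: rf_heat_Suc)
qed

lemma rf_matching_gap:
  assumes "f \<in> rf_matching s" "f \<in> rf_matching t" "s < t" "0 \<le> g f"
  shows "x * max_growth P R g \<le> (real t - real s) * g f"
proof -
  obtain j where "t = Suc (s + j)" using less_imp_Suc_add[OF assms(3)] by auto
  then show ?thesis
    using rf_heat_after_scheduled[OF assms(1,4), of j] assms(2) greedy_matching_hot[of f]
    by (fastforce simp: rf_matching_def)
qed

text \<open>\<open>D\<close> is the length of a run of hot, unscheduled days ending just before
  \<open>d\<close>. The extra \<open>g e\<close> is the increment that carries the heat past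
  \<open>\<theta>\<close>.\<close>

lemma rf_heat_hot_window:
  assumes "0 \<le> \<theta>"
  shows "\<exists>D\<le>d. (\<forall>t\<in>{d - D..<d}. e \<notin> rf_matching t \<and> \<theta> \<le> rf_heat P R g es x t e) \<and>
    rf_heat P R g es x d e \<le> \<theta> + (real D + 1) * g e"
proof (induction d)
  case 0
  then show ?case using assms by simp
next
  case (Suc d)
  show ?case
  proof (cases "e \<in> rf_matching d \<or> rf_heat P R g es x d e < \<theta>")
    case True
    \<comment> \<open>After a reset or a cold day the run is empty, and one increment starts from at
      most \<open>\<theta>\<close>.\<close>
    then show ?thesis using assms by (intro exI[of _ 0]) auto
  next
    case False
    from Suc obtain D where D: "D \<le> d"
      "\<forall>t\<in>{d - D..<d}. e \<notin> rf_matching t \<and> \<theta> \<le> rf_heat P R g es x t e"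
      "rf_heat P R g es x d e \<le> \<theta> + (real D + 1) * g e" by blast
    then show ?thesis using False
      by (intro exI[of _ "Suc D"]) (auto simp: algebra_simps less_Suc_eq)
  qed
qed

end

section \<open>Growth around an edge\<close>

lemma (in ops_instance) finite_edges: "finite R"
  using finite_P simple_edges by (meson Pow_iff finite_Pow_iff rev_finite_subset subsetI)

text \<open>Neighbours of \<open>e\<close> lie in the stars of its two endpoints, each of which
  loses \<open>g e\<close> when \<open>e\<close> is removed.\<close>

lemma (in ops_instance) sum_adjacent_growth_le:
  assumes "e \<in> R" "F \<subseteq> R - {e}" "\<And>f. f \<in> F \<Longrightarrow> e \<inter> f \<noteq> {}"
  shows "sum g F \<le> 2 * (max_growth P R g - g e)"
proof -
  obtain u v where e: "e = {u, v}" "u \<noteq> v"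
    using simple_edges[OF assms(1)] by (auto simp: card_2_iff)
  define N where "N w = {f \<in> R. w \<in> f} - {e}" for w
  have fin: "finite (N w)" for w using finite_edges by (simp add: N_def)
  have nonneg: "0 \<le> g f" if "f \<in> N w" for f w
    using that growth_pos[of f] by (auto simp: N_def)
  have N_le: "sum g (N w) \<le> max_growth P R g - g e" if "w \<in> e" for w
  proof -
    have "sum g (N w) = vertex_growth R g w - g e"
      using that assms(1) finite_edges by (simp add: vertex_growth_def N_def sum_diff1)
    moreover have "vertex_growth R g w \<le> max_growth P R g"
      unfolding max_growth_def using that simple_edges[OF assms(1)] finite_P by (intro Max_ge) auto
    ultimately show ?thesis by simp
  qed
  have "F \<subseteq> N u \<union> N v" using assms e by (force simp: N_def)
  then have "sum g F \<le> sum g (N u \<union> N v)"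
    using fin nonneg by (intro sum_mono2) auto
  also have "\<dots> \<le> sum g (N u) + sum g (N v)"
    using fin nonneg sum.union_inter[of "N u" "N v" g] sum_nonneg[of "N u \<inter> N v" g] by fastforce
  finally show ?thesis using N_le[of u] N_le[of v] e by simp
qed

lemma (in ops_instance) growth_le_max_growth:
  assumes "e \<in> R"
  shows "g e \<le> max_growth P R g"
  using sum_adjacent_growth_le[OF assms, of "{}"] by simp

theorem theorem8:
  fixes P :: "'a set" and R :: "'a set set" and g :: "'a set \<Rightarrow> real"
    and es :: "'a set list" and x :: real
  assumes "ops_instance P R g"
    and "normalised P R g"
    and "fastest_first R g es"
    and "x > 2"
  shows "\<forall>d. \<forall>e\<in>R. rf_heat P R g es x d e
           \<le> max (x + x\<^sup>2 / (4 * (x - 2))) (x + 1/2 + x\<^sup>2 / (4 * (x - 1)))"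
proof (intro allI ballI)
  fix d e assume e: "e \<in> R"
  interpret ops_instance P R g by fact
  have max1: "max_growth P R g = 1" using assms(2) by (simp add: normalised_def)
  have ff: "set es = R" "sorted_wrt (\<lambda>e f. g e \<ge> g f) es"
    using assms(3) by (auto simp: fastest_first_def)
  let ?M = "rf_matching P R g es x"
  obtain D where D: "D \<le> d"
    "\<forall>t\<in>{d - D..<d}. e \<notin> ?M t \<and> x \<le> rf_heat P R g es x t e"
    "rf_heat P R g es x d e \<le> x + (real D + 1) * g e"
    using rf_heat_hot_window[of x d e P R g es x] assms(4) by auto
  have pos: "0 < g e" using growth_pos e by simp
  have "(real D + 1) * g e \<le> x\<^sup>2 / (4 * (x - 2))"
  proof (cases "D = 0")
    case True
    then show ?thesis
      using two_le_excess_bound[OF assms(4)] growth_le_max_growth[OF e] max1 by simp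
  next
    case False
    \<comment> \<open>Days of the run are renumbered from \<open>0\<close>, the form in which
      blockers are counted.\<close>
    have "\<exists>f. f \<in> ?M (d - D + i) \<and> e \<inter> f \<noteq> {} \<and> g e \<le> g f \<and> f \<in> R - {e}" if "i < D" for i
    proof -
      have "d - D + i \<in> {d - D..<d}" using that D(1) by auto
      then show ?thesis
        using D(2) greedy_matching_blocker[OF ff(2), of e] e ff(1) max1
          greedy_matching_hot[of _ _ _ es]
        unfolding rf_matching_def by (metis DiffI mult.right_neutral singletonD)
    qed
    then obtain b where b: "\<And>i. i < D \<Longrightarrow> b i \<in> ?M (d - D + i)" "\<And>i. i < D \<Longrightarrow> e \<inter> b i \<noteq> {}"
      "\<And>i. i < D \<Longrightarrow> g e \<le> g (b i)" "\<And>i. i < D \<Longrightarrow> b i \<in> R - {e}"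
      by metis
    let ?F = "b ` {..<D}"
    have sumF: "sum g ?F \<le> 2 * (1 - g e)"
      using sum_adjacent_growth_le[OF e, of ?F] b max1 by auto
    \<comment> \<open>Every blocker grows at least as fast as \<open>e\<close>, which limits the
      number of blockers.\<close>
    have cardF: "real (card ?F) * g e \<le> sum g ?F"
      using sum_bounded_below[of ?F "g e" g] b(3) by auto
    show ?thesis
    proof (rule overheating_bound[OF assms(4) pos])
      show "real (card ?F) * g e \<le> 2 * (1 - g e)" using cardF sumF by simp
      show "g e \<le> 1" using growth_le_max_growth[OF e] max1 by simp
      show "(real D - real (card ?F)) * x
          \<le> 2 * (1 - g e) * (real D - 1) - g e * real (card ?F) * (real (card ?F) - 1)"
      proof (rule blocked_days_bound)
        show "x \<le> (real t - real s) * g (b t)" if "s < t" "t < D" "b s = b t" for s t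
          using rf_matching_gap[of "b t" P R g es x "d - D + s" "d - D + t"] b(1)[of s] b(1)[of t]
            b(3)[of t] that pos max1 by simp
      qed (use False pos b(3) sumF in auto)
    qed
  qed
  then show "rf_heat P R g es x d e
      \<le> max (x + x\<^sup>2 / (4 * (x - 2))) (x + 1/2 + x\<^sup>2 / (4 * (x - 1)))"
    using D(3) by simp
qed

end
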